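(* Let $n,a_1,a_2,b_1,b_2$ be nonnegative integers such that $(a_1,b_1)\neq(a_2,b_2)$ and, for $i=1,2$, $n>b_i\ge a_i\ge 0$ and $n\ge a_i+b_i+2$. For $i=1,2$ let $\rho_i$ be the (unique) positive real root of $f_i(x)=x^n-x^{b_i}-x^{a_i}$. Then $\rho_1\neq\rho_2$. *)

theory Defs
  imports Complex_Main "HOL-Computational_Algebra.Polynomial"
begin

definition trinom :: "nat \<Rightarrow> nat \<Rightarrow> nat \<Rightarrow> real poly" where
  "trinom n b a = monom 1 n - monom 1 b - monom 1 a"

lemma poly_trinom: "poly (trinom n b a) x = x ^ n - x ^ b - x ^ a"
  by (simp add: trinom_def poly_monom)

text \<open>The phrase ``the positive real root'' is justified: there is exactly one.\<close>

lemma trinom_unique_pos_root: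
  fixes n a b :: nat
  assumes "b < n" "a \<le> b"
  shows "\<exists>!x. 0 < x \<and> poly (trinom n b a) x = 0"
proof (rule ex_ex1I)
  have "\<exists>x\<ge>1. x \<le> 2 \<and> poly (trinom n b a) x = 0"
  proof (rule IVT')
    show "poly (trinom n b a) 1 \<le> 0"
      by (simp add: poly_trinom)
    have "(2::real) ^ b + 2 ^ a \<le> 2 ^ Suc b"
      using assms(2) by (simp add: power_increasing)
    also have "\<dots> \<le> 2 ^ n"
      using assms(1) by (intro power_increasing) auto
    finally show "0 \<le> poly (trinom n b a) 2"
      by (simp add: poly_trinom)
  qed (auto intro: continuous_intros)
  then show "\<exists>x. 0 < x \<and> poly (trinom n b a) x = 0"
    by force
next
  have less: False
    if "0 < x" "x < y" "x ^ n = x ^ b + x ^ a" "y ^ n = y ^ b + y ^ a" for x y :: real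
  proof -
    have eq: "z ^ (n - a) = z ^ (b - a) + 1" if "0 < z" "z ^ n = z ^ b + z ^ a" for z :: real
    proof -
      have "z ^ a * z ^ (n - a) = z ^ a * (z ^ (b - a) + 1)"
        using that(2) assms by (simp add: distrib_left flip: power_add)
      then show ?thesis using that(1) by simp
    qed
    define k m where "k = b - a" and "m = n - b"
    have na: "n - a = k + m" and m: "0 < m"
      using assms by (auto simp: k_def m_def)
    have X: "x ^ k * (x ^ m - 1) = 1" and Y: "y ^ k * (y ^ m - 1) = 1"
      using eq[of x] eq[of y] that by (auto simp: na k_def[symmetric] power_add algebra_simps)
    have "0 < x ^ k" "x ^ k \<le> y ^ k" "x ^ m < y ^ m"
      using that m by (auto intro: power_mono power_strict_mono)
    moreover from this X have "0 < x ^ m - 1"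
      by (metis zero_less_mult_pos zero_less_one)
    ultimately have "x ^ k * (x ^ m - 1) < y ^ k * (y ^ m - 1)"
      by (intro mult_le_less_imp_less) auto
    then show False using X Y by simp
  qed
  fix x y :: real
  assume "0 < x \<and> poly (trinom n b a) x = 0" "0 < y \<and> poly (trinom n b a) y = 0"
  then show "x = y"
    using less[of x y] less[of y x] by (fastforce simp: poly_trinom)
qed

end

theory Submission imports Defs begin

text \<open>
  Suppose the two trinomials share a positive root \<open>x\<close>; then \<open>x > 1\<close>. Monotonicity of powers of
  \<open>x\<close> shows that the exponents are nested, say \<open>a1 < a2 \<le> b2 < b1\<close>. After division by
  \<open>x ^ a1\<close> and \<open>x ^ a2\<close>, the number \<open>x\<close> is a root of \<open>f = X^N - X^B - 1\<close> and of
  \<open>g = X^M - X^e - 1\<close> with \<open>M < N\<close> and \<open>e < B\<close>. Write \<open>p*\<close> for the reciprocal polynomial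
  of \<open>p\<close>, and let \<open>m\<close> be the primitive integer minimal polynomial of \<open>x\<close>, so that
  \<open>f = m u\<close> and \<open>g = m v\<close> over the integers.

  The core is Ljunggren's argument. The polynomial \<open>F = m* u\<close> satisfies \<open>F F* = f f*\<close>. The middle
  coefficient of \<open>F F*\<close> is the sum of the squares of the coefficients of \<open>F\<close>, here 3; hence \<open>F\<close>
  is itself a trinomial with coefficients \<open>\<plusminus>1\<close>, and comparing the other exponents leaves only
  \<open>\<plusminus>f\<close> and \<open>\<plusminus>f*\<close> (\<open>times_reflect_eq_int_trinom\<close>). The first option would make \<open>m\<close>
  self-reciprocal up to sign, so \<open>1/x\<close> would be a root of \<open>f\<close>; but \<open>f\<close> is negative on
  \<open>(0, 1)\<close>. The second option says \<open>u* = \<plusminus>u\<close> (\<open>cofactor_self_reciprocal\<close>).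

  When \<open>e > 0\<close> the same holds for \<open>v\<close>, and therefore \<open>f g* = \<plusminus>f* g\<close>, where the constant terms
  force the sign \<open>+\<close>. Both sides are explicit sums of monomials, and matching their exponents
  (\<open>exchange_exponents\<close>) leaves the single family \<open>f = X^(5e) - X^(4e) - 1\<close>,
  \<open>g = X^(3e) - X^e - 1\<close>. These two really do share a root, since
  \<open>X^5 - X^4 - 1 = (X^2 - X + 1)(X^3 - X - 1)\<close>; the hypothesis \<open>n \<ge> a2 + b2 + 2\<close> is what excludes
  them. When \<open>e = 0\<close>, the polynomial \<open>g\<close> is \<open>X^M - 2\<close>, and a parity argument in the style of
  Eisenstein shows that it shares no root with \<open>f\<close>, whose constant term is odd.
\<close>

section \<open>Integer polynomials at a real point\<close>

definition int_poly_eval :: "int poly \<Rightarrow> real \<Rightarrow> real" where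
  "int_poly_eval p x = poly (map_poly of_int p) x"

lemma int_poly_eval_add: "int_poly_eval (p + q) x = int_poly_eval p x + int_poly_eval q x"
proof -
  have "map_poly real_of_int (p + q) = map_poly of_int p + map_poly of_int q"
    by (rule poly_eqI) (simp add: coeff_map_poly)
  then show ?thesis by (simp add: int_poly_eval_def)
qed

lemma int_poly_eval_mult: "int_poly_eval (p * q) x = int_poly_eval p x * int_poly_eval q x"
proof -
  have "map_poly real_of_int (p * q) = map_poly of_int p * map_poly of_int q"
    by (rule poly_eqI) (simp add: coeff_map_poly coeff_mult)
  then show ?thesis by (simp add: int_poly_eval_def)
qed

lemma int_poly_eval_smult: "int_poly_eval (smult c p) x = of_int c * int_poly_eval p x"
proof -
  have "map_poly real_of_int (smult c p) = smult (of_int c) (map_poly of_int p)"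
    by (rule poly_eqI) (simp add: coeff_map_poly)
  then show ?thesis by (simp add: int_poly_eval_def)
qed

lemma int_poly_eval_uminus: "int_poly_eval (- p) x = - int_poly_eval p x"
  using int_poly_eval_smult[of "-1" p x] by simp

lemma int_poly_eval_diff: "int_poly_eval (p - q) x = int_poly_eval p x - int_poly_eval q x"
  using int_poly_eval_add[of p "- q" x] by (simp add: int_poly_eval_uminus)

lemma int_poly_eval_monom: "int_poly_eval (monom c k) x = of_int c * x ^ k"
  by (simp add: int_poly_eval_def map_poly_monom poly_monom)

lemma int_poly_eval_1: "int_poly_eval 1 x = 1"
  by (simp add: int_poly_eval_def)

lemma int_poly_eval_reflect:
  assumes "x \<noteq> 0"
  shows "int_poly_eval (reflect_poly p) x = x ^ degree p * int_poly_eval p (inverse x)"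
proof -
  have deg: "degree (map_poly real_of_int p) = degree p"
    by (rule degree_map_poly) auto
  have "map_poly real_of_int (reflect_poly p) = reflect_poly (map_poly of_int p)"
    by (rule poly_eqI) (simp add: coeff_map_poly coeff_reflect_poly deg)
  then show ?thesis
    using assms by (simp add: int_poly_eval_def poly_reflect_poly_nz deg)
qed

text \<open>Take a polynomial of least degree vanishing at \<open>x\<close> and divide by its content. Pseudo-division
  shows that it divides some integer multiple of every other such polynomial; because it is
  primitive, Gauss's lemma moves the multiplier into the quotient, so divisibility holds over the
  integers and not merely over the rationals.\<close>

lemma int_minimal_poly_exists:
  fixes x :: real
  assumes "f \<noteq> 0" "int_poly_eval f x = 0"
  obtains m where "int_poly_eval m x = 0" "\<And>p. int_poly_eval p x = 0 \<Longrightarrow> m dvd p"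
proof -
  define P where "P = (\<lambda>p. p \<noteq> 0 \<and> int_poly_eval p x = 0)"
  have "P f" using assms by (simp add: P_def)
  then obtain m0 where m0: "P m0" and least: "\<And>p. P p \<Longrightarrow> degree m0 \<le> degree p"
    using ex_has_least_nat[of P f degree] by blast
  define m where "m = primitive_part m0"
  have "m \<noteq> 0" and cont: "content m = 1" and deg: "degree m = degree m0"
    using m0 by (simp_all add: m_def P_def)
  have "int_poly_eval m0 x = of_int (content m0) * int_poly_eval m x"
    by (simp add: m_def flip: int_poly_eval_smult)
  then have ev: "int_poly_eval m x = 0"
    using m0 by (auto simp: P_def)
  have "m dvd p" if p: "int_poly_eval p x = 0" for p
  proof -
    define r where "r = pseudo_mod p m"
    obtain a q where a: "a \<noteq> 0" and eq: "smult a p = m * q + r"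
      using pseudo_mod(1)[OF \<open>m \<noteq> 0\<close>, of p] by (auto simp: r_def)
    have "int_poly_eval r x = 0"
      using arg_cong[OF eq, of "\<lambda>h. int_poly_eval h x"] p ev
      by (simp add: int_poly_eval_add int_poly_eval_mult int_poly_eval_smult)
    then have "r = 0"
      using pseudo_mod(2)[OF \<open>m \<noteq> 0\<close>, of p] least[of r] deg
      unfolding P_def r_def by linarith
    with eq have eq': "smult a p = m * q" by simp
    have "a dvd content q"
      using arg_cong[OF eq', of content] cont
      by (simp add: content_mult) (metis dvd_triv_left normalize_int_def abs_dvd_iff)
    then have "[:a:] dvd q"
      by (simp add: const_poly_dvd_iff_dvd_content)
    then obtain q' where "q = smult a q'"
      by (auto elim: dvdE)
    with eq' have "smult a p = smult a (m * q')" by simp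
    with a show ?thesis
      by (metis dvd_triv_left smult_cancel)
  qed
  with ev that show ?thesis by blast
qed

section \<open>Trinomials and their reciprocals\<close>

text \<open>The middle coefficient is a parameter because the reciprocal of \<open>X^N - X^B - 1\<close> is, up to sign,
  \<open>X^N + X^(N-B) - 1\<close>: the value \<open>s = -1\<close> gives the former and \<open>s = 1\<close> the latter.\<close>

definition int_trinom :: "nat \<Rightarrow> nat \<Rightarrow> int \<Rightarrow> int poly" where
  "int_trinom N k s = monom 1 N + monom s k - 1"

lemma coeff_1_poly: "coeff 1 j = (if j = 0 then 1 else 0)"
  by (simp add: one_pCons coeff_pCons split: nat.split)

lemma coeff_int_trinom:
  "coeff (int_trinom N k s) j
    = (if j = N then 1 else 0) + (if j = k then s else 0) - (if j = 0 then 1 else 0)"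
  by (auto simp: int_trinom_def coeff_1_poly)

lemma degree_int_trinom: "k < N \<Longrightarrow> degree (int_trinom N k s) = N"
  by (rule order.antisym[OF degree_le le_degree]) (auto simp: coeff_int_trinom)

lemma reflect_int_trinom:
  assumes "k < N"
  shows "reflect_poly (int_trinom N k s) = 1 + monom s (N - k) - monom 1 N"
  using assms
  by (intro poly_eqI) (auto simp: coeff_reflect_poly degree_int_trinom coeff_int_trinom coeff_1_poly)

text \<open>The first summand carries all the information about \<open>k\<close> and \<open>s\<close>; the second is common to all
  trinomials of degree \<open>N\<close> and cancels when two such products are compared.\<close>

lemma int_trinom_times_reflect:
  assumes "k < N" "s * s = 1"
  shows "int_trinom N k s * reflect_poly (int_trinom N k s)
    = smult s (monom 1 (2*N - k) - monom 1 (N + k) + monom 1 k - monom 1 (N - k))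
      + (monom 3 N - monom 1 (2*N) - 1)"
proof -
  have e: "N + (N - k) = 2*N - k" "k + (N - k) = N" "k + N = N + k" "N + N = 2*N"
    using assms by auto
  have "monom (3::int) N = monom 1 N + monom 1 N + monom 1 N"
    by (simp add: add_monom)
  then show ?thesis
    using assms(1)
    by (simp add: reflect_int_trinom)
       (simp add: int_trinom_def algebra_simps mult_monom smult_monom smult_add_right smult_diff_right e assms(2))
qed

lemma reflect_poly_uminus: "reflect_poly (- p) = - reflect_poly (p :: int poly)"
  using reflect_poly_smult[of "-1" p] by simp

text \<open>Reversal turns the convolution at the middle index into the inner product of the coefficient
  vector with itself. For integer polynomials this controls the number of terms.\<close>

lemma coeff_times_reflect_middle:
  fixes p :: "int poly"
  shows "coeff (p * reflect_poly p) (degree p) = (\<Sum>i\<le>degree p. (coeff p i)\<^sup>2)"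
  unfolding coeff_mult
  by (intro sum.cong) (auto simp: coeff_reflect_poly power2_eq_square)

lemma sum_squares_eq_1:
  fixes c :: "nat \<Rightarrow> int"
  assumes "finite A" "(\<Sum>i\<in>A. (c i)\<^sup>2) = 1"
  obtains k where "k \<in> A" "c k * c k = 1" "\<And>i. i \<in> A \<Longrightarrow> i \<noteq> k \<Longrightarrow> c i = 0"
proof -
  obtain k where k: "k \<in> A" "c k \<noteq> 0"
    using assms(2) by (fastforce intro: ccontr)
  have split: "(c k)\<^sup>2 + (\<Sum>i\<in>A-{k}. (c i)\<^sup>2) = 1"
    using assms k by (simp add: sum.remove)
  have "(c k)\<^sup>2 \<ge> 1"
    using k by (simp add: int_one_le_iff_zero_less)
  moreover have "(\<Sum>i\<in>A-{k}. (c i)\<^sup>2) \<ge> 0"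
    by (simp add: sum_nonneg)
  ultimately have "(c k)\<^sup>2 = 1" "(\<Sum>i\<in>A-{k}. (c i)\<^sup>2) = 0"
    using split by linarith+
  then show ?thesis
    using that[of k] k assms(1) by (auto simp: sum_nonneg_eq_0_iff power2_eq_square)
qed

text \<open>The product determines \<open>lead_coeff F * coeff F 0 = -1\<close>, and its middle coefficient says that the
  squares of all coefficients of \<open>F\<close> add up to 3. The two end coefficients use up 2, so exactly one
  inner coefficient is nonzero and it is \<open>\<plusminus>1\<close>. It remains to locate it.\<close>

lemma times_reflect_eq_int_trinom_monic:
  assumes B: "0 < B" "B < N" and lc: "lead_coeff F = 1"
    and eq: "F * reflect_poly F = int_trinom N B (-1) * reflect_poly (int_trinom N B (-1))"
  shows "F = int_trinom N B (-1) \<or> F = - reflect_poly (int_trinom N B (-1))"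
proof -
  have prod: "int_trinom N B (-1) * reflect_poly (int_trinom N B (-1))
      = smult (-1) (monom 1 (2*N - B) - monom 1 (N + B) + monom 1 B - monom 1 (N - B))
        + (monom 3 N - monom 1 (2*N) - 1)"
    by (rule int_trinom_times_reflect) (use B in auto)
  have F0: "coeff F 0 = -1"
    using arg_cong[OF eq, of "\<lambda>h. coeff h 0"] B lc
    by (simp add: coeff_mult_0 coeff_int_trinom degree_int_trinom)
  have "degree (F * reflect_poly F) = 2 * degree F"
    using F0 by (subst degree_mult_eq) auto
  moreover have "degree (int_trinom N B (-1) * reflect_poly (int_trinom N B (-1))) = 2 * N"
    using B degree_int_trinom[OF B(2), of "-1"]
    by (subst degree_mult_eq) (auto simp: coeff_int_trinom)
  ultimately have deg: "degree F = N" using eq by simp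
  have "(\<Sum>i\<le>N. (coeff F i)\<^sup>2) = 3"
    using coeff_times_reflect_middle[of F] B
    unfolding eq prod deg by (auto simp: coeff_1_poly split: if_splits)
  moreover have "{..N} = insert 0 (insert N {1..<N})" using B by auto
  ultimately have "(\<Sum>i\<in>{1..<N}. (coeff F i)\<^sup>2) = 1"
    using B F0 lc deg by simp
  then obtain k where k: "k \<in> {1..<N}" and s: "coeff F k * coeff F k = 1"
    and others: "\<And>i. i \<in> {1..<N} \<Longrightarrow> i \<noteq> k \<Longrightarrow> coeff F i = 0"
    using sum_squares_eq_1[of "{1..<N}" "coeff F"] by blast
  define s where "s = coeff F k"
  have F: "F = int_trinom N k s"
  proof (rule poly_eqI)
    fix j
    consider "j = 0" | "j = N" | "j = k" | "j > N" | "j \<in> {1..<N}" "j \<noteq> k"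
      by fastforce
    then show "coeff F j = coeff (int_trinom N k s) j"
      using k B F0 lc deg others[of j]
      by cases (auto simp: coeff_int_trinom s_def coeff_eq_0)
  qed
  have kN: "k < N" "0 < k" using k by auto
  have ss: "s * s = 1" using s by (simp add: s_def)
  then have s1: "s = 1 \<or> s = -1" 
    using pos_zmult_eq_1_iff_lemma by blast
  have coeffs: "coeff (smult s (monom 1 (2*N - k) - monom 1 (N + k) + monom 1 k - monom 1 (N - k))) j
      = coeff (smult (-1) (monom 1 (2*N - B) - monom 1 (N + B) + monom 1 B - monom 1 (N - B))) j" for j
    using eq unfolding prod F int_trinom_times_reflect[OF kN(1) ss]
    by (simp only: add_right_cancel)
  \<comment> \<open>Only the exponents \<open>k, N - k, B, N - B\<close> lie below \<open>N\<close>, so the coefficients at \<open>B\<close> and \<open>k\<close>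
    decide. If \<open>N = 2 * B\<close>, everything cancels and \<open>k = B\<close> with either sign of \<open>s\<close>, which the two
    alternatives cover as well.\<close>
  have "k = B \<and> s = -1 \<or> k = N - B \<and> s = 1"
  proof -
    have low: "2*N - i \<noteq> j" "N + i \<noteq> j" if "i < N" "j < N" for i j
      using that by auto
    have "s * ((if k = B then 1 else 0) - (if N - k = B then 1 else 0))
        = (if N - B = B then 1 else 0) - 1"
      using coeffs[of B] low[OF kN(1) B(2)] low[OF B(2) B(2)] by simp
    moreover have "s * (1 - (if N - k = k then 1 else 0))
        = (if N - B = k then 1 else 0) - (if B = k then 1 else 0)"
      using coeffs[of k] low[OF kN(1) kN(1)] low[OF B(2) kN(1)] by simp
    ultimately show ?thesis
      using s1 B kN by (cases "k = B"; cases "N - k = B"; cases "N - B = B") (auto split: if_splits)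
  qed
  then show ?thesis
  proof
    assume "k = B \<and> s = -1"
    then show ?thesis using F by simp
  next
    assume k: "k = N - B \<and> s = 1"
    have "monom (-1::int) (N - B) = - monom 1 (N - B)" by (simp add: minus_monom)
    then have "int_trinom N (N - B) 1 = - reflect_poly (int_trinom N B (-1))"
      using B(2) by (simp add: reflect_int_trinom) (simp add: int_trinom_def)
    then show ?thesis using F k by simp
  qed
qed

lemma times_reflect_eq_int_trinom:
  assumes B: "0 < B" "B < N"
    and eq: "F * reflect_poly F = int_trinom N B (-1) * reflect_poly (int_trinom N B (-1))"
  shows "F = int_trinom N B (-1) \<or> F = - int_trinom N B (-1) \<or>
    F = reflect_poly (int_trinom N B (-1)) \<or> F = - reflect_poly (int_trinom N B (-1))"
proof -
  have "coeff F 0 * lead_coeff F = -1"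
    using arg_cong[OF eq, of "\<lambda>h. coeff h 0"] B
    by (simp add: coeff_mult_0 coeff_int_trinom degree_int_trinom)
  then have "is_unit (lead_coeff F)"
    by (metis dvd_def dvd_minus_iff mult.commute)
  then consider "lead_coeff F = 1" | "lead_coeff (- F) = 1"
    by (auto simp: abs_eq_iff')
  then show ?thesis
  proof cases
    case 1
    then show ?thesis using times_reflect_eq_int_trinom_monic[OF B _ eq] by blast
  next
    case 2
    have "(- F) * reflect_poly (- F) = int_trinom N B (-1) * reflect_poly (int_trinom N B (-1))"
      using eq by (simp add: reflect_poly_uminus)
    from times_reflect_eq_int_trinom_monic[OF B 2 this] show ?thesis
      by (metis minus_minus)
  qed
qed

section \<open>The cofactor of the minimal polynomial\<close>

lemma int_poly_eval_int_trinom: "int_poly_eval (int_trinom N B (-1)) x = x ^ N - x ^ B - 1"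
  by (simp add: int_trinom_def int_poly_eval_add int_poly_eval_diff int_poly_eval_monom int_poly_eval_1)

text \<open>Reversing the factor \<open>m\<close> in \<open>m * u\<close> does not change the product with the reciprocal, so the
  classification above applies to \<open>reflect_poly m * u\<close>. Since \<open>m\<close> vanishes at \<open>x > 1\<close> but not at
  \<open>1/x\<close>, reversing \<open>m\<close> really changes it, and then the reversal of \<open>m\<close> must have been cancelled by
  a symmetry of \<open>u\<close>.\<close>

lemma cofactor_self_reciprocal:
  fixes x :: real
  assumes B: "0 < B" "B < N" and x: "x > 1" "int_poly_eval m x = 0"
    and mu: "int_trinom N B (-1) = m * u"
  shows "reflect_poly u = u \<or> reflect_poly u = - u"
proof -
  define f where "f = int_trinom N B (-1)"
  have f: "f = m * u" using mu by (simp add: f_def)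
  have "coeff f 0 \<noteq> 0" using B by (simp add: f_def coeff_int_trinom)
  then have m0: "coeff m 0 \<noteq> 0" and u0: "coeff u 0 \<noteq> 0"
    by (auto simp: f coeff_mult_0)
  then have nz: "m \<noteq> 0" "u \<noteq> 0" by auto
  have not_recip: "reflect_poly m \<noteq> m" "reflect_poly m \<noteq> - m"
  proof -
    have "int_poly_eval m (inverse x) \<noteq> 0"
    proof
      assume "int_poly_eval m (inverse x) = 0"
      then have "int_poly_eval f (inverse x) = 0" by (simp add: f int_poly_eval_mult)
      then have "inverse x ^ N = inverse x ^ B + 1"
        by (simp add: f_def int_poly_eval_int_trinom)
      moreover have "inverse x ^ N \<le> 1" using x by (intro power_le_one) (auto simp: inverse_le_1_iff)
      moreover have "inverse x ^ B > 0" using x by simp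
      ultimately show False by linarith
    qed
    moreover have "int_poly_eval (reflect_poly m) (inverse x) = 0"
      using x by (simp add: int_poly_eval_reflect)
    ultimately show "reflect_poly m \<noteq> m" "reflect_poly m \<noteq> - m"
      by (auto simp: int_poly_eval_uminus)
  qed
  define F where "F = reflect_poly m * u"
  have "F * reflect_poly F = f * reflect_poly f"
    using m0 by (simp add: F_def f reflect_poly_mult mult_ac)
  from times_reflect_eq_int_trinom[OF B this[unfolded f_def]]
  consider "F = f" | "F = - f" | "F = reflect_poly f" | "F = - reflect_poly f"
    by (auto simp: f_def)
  then show ?thesis
  proof cases
    case 1
    then have "reflect_poly m * u = m * u" by (simp add: F_def f)
    then show ?thesis using nz not_recip by simp
  next
    case 2
    then have "reflect_poly m * u = (- m) * u" by (simp add: F_def f)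
    then show ?thesis using nz not_recip by (simp only: mult_cancel_right) simp
  next
    case 3
    then have "reflect_poly m * u = reflect_poly m * reflect_poly u"
      by (simp add: F_def f reflect_poly_mult)
    then show ?thesis using nz by simp
  next
    case 4
    then have "reflect_poly m * u = reflect_poly m * (- reflect_poly u)"
      by (simp add: F_def f reflect_poly_mult)
    then have "u = - reflect_poly u" using nz by (simp only: mult_cancel_left) simp
    then show ?thesis by simp
  qed
qed

text \<open>Two trinomials with a common root have cofactors \<open>u\<close>, \<open>v\<close> of the same \<open>m\<close>. As these are
  self-reciprocal up to sign, both sides equal \<open>m * reflect_poly m * u * v\<close> up to sign; equality of
  the constant terms fixes the sign. The factor \<open>m\<close> itself no longer appears.\<close>

lemma int_trinom_times_reflect_exchange:
  fixes x :: real
  assumes B: "0 < B" "B < N" and e: "0 < e" "e < M" and x: "x > 1"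
    and f0: "int_poly_eval (int_trinom N B (-1)) x = 0"
    and g0: "int_poly_eval (int_trinom M e (-1)) x = 0"
  shows "int_trinom N B (-1) * reflect_poly (int_trinom M e (-1))
    = reflect_poly (int_trinom N B (-1)) * int_trinom M e (-1)"
proof -
  define f g where "f = int_trinom N B (-1)" and "g = int_trinom M e (-1)"
  have c0: "coeff f 0 = -1" "coeff g 0 = -1" "lead_coeff f = 1" "lead_coeff g = 1"
    using B e by (simp_all add: f_def g_def coeff_int_trinom degree_int_trinom)
  then have "f \<noteq> 0" by auto
  obtain m where m: "int_poly_eval m x = 0" "\<And>p. int_poly_eval p x = 0 \<Longrightarrow> m dvd p"
    using int_minimal_poly_exists[OF \<open>f \<noteq> 0\<close>] f0 by (auto simp: f_def)
  obtain u v where u: "f = m * u" and v: "g = m * v"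
    using m(2)[OF f0] m(2)[OF g0] by (auto simp: f_def g_def elim!: dvdE)
  have nz: "m \<noteq> 0" "u \<noteq> 0" "v \<noteq> 0" using c0 u v by auto
  have uv: "reflect_poly u = u \<or> reflect_poly u = - u"
      "reflect_poly v = v \<or> reflect_poly v = - v"
    using cofactor_self_reciprocal[OF B x m(1)] cofactor_self_reciprocal[OF e x m(1)] u v
    by (auto simp: f_def g_def)
  have "f * reflect_poly g = reflect_poly f * g \<or> f * reflect_poly g = - (reflect_poly f * g)"
    using uv by (auto simp: u v reflect_poly_mult)
  moreover have "coeff (f * reflect_poly g) 0 = coeff (reflect_poly f * g) 0"
      "coeff (reflect_poly f * g) 0 = -1"
    using c0 by (simp_all add: coeff_mult_0)
  ultimately have "f * reflect_poly g = reflect_poly f * g"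
    by auto
  then show ?thesis by (simp add: f_def g_def)
qed

section \<open>Comparing exponents\<close>

text \<open>After cancellation each side of the identity is a sum of five monomials with coefficient 1, so
  every exponent on the right occurs on the left. Locating \<open>e\<close>, then \<open>e + M\<close>, then \<open>B + M - e\<close>
  gives three linear equations.\<close>

lemma exchange_exponents:
  assumes B: "0 < B" "B < N" and e: "0 < e" "e < M" and less: "e < B" "M < N"
    and eq: "int_trinom N B (-1) * reflect_poly (int_trinom M e (-1))
      = reflect_poly (int_trinom N B (-1)) * int_trinom M e (-1)"
  shows "N = 5 * e \<and> M = 3 * e \<and> B = 4 * e"
proof -
  have minus: "monom (-1::int) j = - monom 1 j" for j by (simp add: minus_monom)
  have "monom 1 (N + (M - e)) + monom 1 B + monom 1 (N - B + e) + monom 1 (N + e) + monom 1 (N - B)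
      = (monom 1 (N - B + M) + monom 1 e + monom 1 (B + (M - e)) + monom 1 (B + M)
        + monom 1 (M - e) :: int poly)"
    using eq B e
    by (simp add: reflect_int_trinom)
       (simp add: int_trinom_def minus algebra_simps mult_monom add.commute)
  then have coeffs: "coeff (monom 1 (N + (M - e)) + monom 1 B + monom 1 (N - B + e)
        + monom 1 (N + e) + monom 1 (N - B)) j
      = coeff (monom 1 (N - B + M) + monom 1 e + monom 1 (B + (M - e)) + monom 1 (B + M)
        + monom 1 (M - e) :: int poly) j" for j
    by simp
  have mem: "j \<in> {N + (M - e), B, N - B + e, N + e, N - B}"
    if j: "j \<in> {N - B + M, e, B + (M - e), B + M, M - e}" for j
  proof (rule ccontr)
    assume notin: "\<not> ?thesis"
    define c :: "nat \<Rightarrow> int" where "c i = (if i = j then 1 else 0)" for i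
    have "c (N + (M - e)) + c B + c (N - B + e) + c (N + e) + c (N - B)
        = c (N - B + M) + c e + c (B + (M - e)) + c (B + M) + c (M - e)"
      using coeffs[of j] by (simp add: c_def)
    moreover have "c (N + (M - e)) = 0" "c B = 0" "c (N - B + e) = 0" "c (N + e) = 0" "c (N - B) = 0"
      using notin by (simp_all add: c_def)
    moreover have nonneg: "c i \<ge> 0" for i by (simp add: c_def)
    moreover have "c j = 1" by (simp add: c_def)
    ultimately show False
      using j nonneg[of "N - B + M"] nonneg[of e] nonneg[of "B + (M - e)"] nonneg[of "B + M"]
        nonneg[of "M - e"]
      by (elim insertE emptyE; hypsubst; linarith)
  qed
  have N: "N = B + e"
    using mem[of e] B e less by auto
  have M: "M + e = B"
    using mem[of "e + M"] B e less by (auto simp: N)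
  have "B + (M - e) \<in> {N + (M - e), B, N - B + e, N + e, N - B}"
    by (rule mem) simp
  then have "B = 4 * e"
    using M B e by (auto simp: N)
  with N M show ?thesis by simp
qed

text \<open>Let \<open>m\<close> be the minimal polynomial of \<open>x\<close>. Being a divisor of \<open>X^N - X^B - 1\<close>, it has odd
  constant term. If also \<open>X^M - 2 = m v\<close>, then, from the constant term upwards, all coefficients of
  \<open>v\<close> below index \<open>M\<close> are even, while the leading one is \<open>\<plusminus>1\<close>. So \<open>v\<close> has degree \<open>M\<close> and
  \<open>m\<close> is a nonzero constant, which has no root.\<close>

lemma no_common_root_power_eq_2:
  fixes x :: real
  assumes B: "0 < B" "B < N" and M: "0 < M"
    and f0: "int_poly_eval (int_trinom N B (-1)) x = 0"
  shows "x ^ M \<noteq> 2"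
proof
  assume x: "x ^ M = 2"
  define f g where "f = int_trinom N B (-1)" and "g = int_trinom M 0 (-1)"
  have c0: "coeff f 0 = -1" "lead_coeff f = 1" "lead_coeff g = 1" "degree g = M"
    using B M by (simp_all add: f_def g_def coeff_int_trinom degree_int_trinom)
  then have "f \<noteq> 0" by auto
  have g0: "int_poly_eval g x = 0"
    using x by (simp add: g_def int_poly_eval_int_trinom)
  obtain m where m: "int_poly_eval m x = 0" "\<And>p. int_poly_eval p x = 0 \<Longrightarrow> m dvd p"
    using int_minimal_poly_exists[OF \<open>f \<noteq> 0\<close>] f0 by (auto simp: f_def)
  obtain u v where u: "f = m * u" and v: "g = m * v"
    using m(2)[OF f0] m(2)[OF g0] by (auto simp: f_def elim!: dvdE)
  have nz: "m \<noteq> 0" "v \<noteq> 0" using c0 u v by auto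
  have odd: "odd (coeff m 0)"
  proof
    assume "even (coeff m 0)"
    then have "even (coeff f 0)" by (simp add: u coeff_mult_0)
    then show False using c0 by simp
  qed
  have even: "even (coeff v k)" if "k < M" for k
    using that
  proof (induction k rule: less_induct)
    case (less k)
    have "even (coeff g k)" using less.prems by (simp add: g_def coeff_int_trinom)
    also have "coeff g k = (\<Sum>i\<le>k. coeff v i * coeff m (k - i))"
      by (simp add: v coeff_mult mult.commute[of m])
    also have "\<dots> = (\<Sum>i<k. coeff v i * coeff m (k - i)) + coeff v k * coeff m 0"
      by (simp flip: lessThan_Suc_atMost)
    finally have "even \<dots>" .
    moreover have "even (\<Sum>i<k. coeff v i * coeff m (k - i))"
      using less by (intro dvd_sum) auto
    ultimately show ?case using odd by simp
  qed
  have "lead_coeff m * lead_coeff v = 1"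
    using c0 by (simp add: v lead_coeff_mult)
  then have "odd (lead_coeff v)" by (metis dvd_mult odd_one)
  with even[of "degree v"] have "degree v \<ge> M" by force
  moreover have "degree m + degree v = M"
    using nz c0 by (simp add: v degree_mult_eq)
  ultimately have "degree m = 0" by simp
  then obtain c where "m = [:c:]" by (rule degree_eq_zeroE)
  with m(1) nz show False by (simp add: int_poly_eval_def map_poly_pCons)
qed

text \<open>Removing the powers \<open>x ^ a1\<close> and \<open>x ^ a2\<close> brings both equations into the shape
  \<open>X^N - X^B - 1\<close>. In these terms \<open>n \<ge> a2 + b2 + 2\<close> gives \<open>M \<ge> e + (N - M) + 2\<close>, which contradicts
  \<open>N = 5 * e\<close> and \<open>M = 3 * e\<close>.\<close>

lemma trinom_no_common_root_if_less:
  fixes n a1 a2 b1 b2 :: nat and x :: real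
  assumes "b1 < n" "a1 \<le> b1" "a2 \<le> b2" "n \<ge> a2 + b2 + 2" "b2 < b1"
    and x: "x > 0" and r1: "x ^ n = x ^ b1 + x ^ a1" and r2: "x ^ n = x ^ b2 + x ^ a2"
  shows False
proof -
  have "x > 1"
  proof (rule ccontr)
    assume "\<not> x > 1"
    then have "x ^ n \<le> x ^ a1"
      using assms by (intro power_decreasing) auto
    moreover have "x ^ b1 > 0" using x by simp
    ultimately show False using r1 by linarith
  qed
  have "x ^ b2 < x ^ b1" using \<open>b2 < b1\<close> \<open>x > 1\<close> by simp
  then have "x ^ a1 < x ^ a2" using r1 r2 by linarith
  then have a: "a1 < a2" using \<open>x > 1\<close> by simp
  define N B M e where "N = n - a1" and "B = b1 - a1" and "M = n - a2" and "e = b2 - a2"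
  have shift: "x ^ (n - a) - x ^ (b - a) - 1 = 0"
    if "x ^ n = x ^ b + x ^ a" "a \<le> b" "b < n" for a b
  proof -
    have "x ^ a * (x ^ (n - a) - x ^ (b - a) - 1) = 0"
      using that by (simp add: right_diff_distrib flip: power_add)
    then show ?thesis using x by simp
  qed
  have f0: "int_poly_eval (int_trinom N B (-1)) x = 0"
    using shift[OF r1] assms by (simp add: int_poly_eval_int_trinom N_def B_def)
  have g0: "int_poly_eval (int_trinom M e (-1)) x = 0"
    using shift[OF r2] assms by (simp add: int_poly_eval_int_trinom M_def e_def)
  have B: "0 < B" "B < N" and M: "0 < M" and eM: "e < M" and less: "e < B" "M < N"
    using assms a by (auto simp: N_def B_def M_def e_def)
  show False
  proof (cases "e = 0")
    case True
    then have "x ^ M = 2" using g0 by (simp add: int_poly_eval_int_trinom)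
    then show False using no_common_root_power_eq_2[OF B M f0] by simp
  next
    case False
    then have e: "0 < e" by simp
    have "N = 5 * e \<and> M = 3 * e \<and> B = 4 * e"
      using exchange_exponents[OF B e eM less]
        int_trinom_times_reflect_exchange[OF B e eM \<open>x > 1\<close> f0 g0] by blast
    then show False
      using assms a by (auto simp: N_def B_def M_def e_def)
  qed
qed

theorem theorem4p10:
  fixes n a1 a2 b1 b2 :: nat and \<rho>1 \<rho>2 :: real
  assumes "(a1, b1) \<noteq> (a2, b2)"
    and "n > b1" and "b1 \<ge> a1" and "n \<ge> a1 + b1 + 2"
    and "n > b2" and "b2 \<ge> a2" and "n \<ge> a2 + b2 + 2"
    and "\<rho>1 > 0" and "poly (trinom n b1 a1) \<rho>1 = 0"
    and "\<rho>2 > 0" and "poly (trinom n b2 a2) \<rho>2 = 0"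
  shows "\<rho>1 \<noteq> \<rho>2"
proof
  assume eq: "\<rho>1 = \<rho>2"
  have r1: "\<rho>1 ^ n = \<rho>1 ^ b1 + \<rho>1 ^ a1" and r2: "\<rho>1 ^ n = \<rho>1 ^ b2 + \<rho>1 ^ a2"
    using assms eq by (simp_all add: poly_trinom)
  consider "b2 < b1" | "b1 < b2" | "b1 = b2" by linarith
  then show False
  proof cases
    case 1
    then show False using trinom_no_common_root_if_less[of b1 n a1 a2 b2 \<rho>1] assms r1 r2 by simp
  next
    case 2
    then show False using trinom_no_common_root_if_less[of b2 n a2 a1 b1 \<rho>1] assms r1 r2 by simp
  next
    case 3
    then have pow: "\<rho>1 ^ a1 = \<rho>1 ^ a2" using r1 r2 by simp
    have "\<rho>1 \<noteq> 1" using r1 by auto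
    then have "a1 = a2" using pow \<open>\<rho>1 > 0\<close> by (simp add: power_inject_exp')
    then show False using 3 assms(1) by simp
  qed
qed

end
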